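(* Let $F:\mathbb{R}^3\setminus\{\mathbf 0\}\to\mathbb{C}$ be a kernel and $s:\mathbb{R}\setminus\{0\}\to\mathbb{C}$ a function such that $F(\alpha\mathbf r)=s(\alpha)F(\mathbf r)$ for all $\alpha\in\mathbb{R}\setminus\{0\}$ and all $\mathbf r\neq\mathbf 0$. Let $\mathrm S,\mathrm R\subset\mathbb{R}^3$ be (nondegenerate, closed) triangles such that $(\mathbf x,\mathbf x')\mapsto F(\mathbf x-\mathbf x')$ is absolutely integrable over $\mathrm R\times\mathrm S$ with respect to surface measure, and let $\mathbf p,\mathbf p'\in\mathbb{R}^3$. Let $\alpha\in\mathbb{R}\setminus\{0\}$ and $\mathbf t\in\mathbb{R}^3$, and let $\mathrm S_\ast=\{\alpha(\mathbf x'+\mathbf t):\mathbf x'\in\mathrm S\}$ and $\mathrm R_\ast=\{\alpha(\mathbf x+\mathbf t):\mathbf x\in\mathrm R\}$. Write $I^1,I^{\mathbf p'},I^{\mathbf p},I^{\mathbf p'\mathbf p}$ for the integrals $I^1_{\mathrm S\mathrm R},I^{\mathbf p'}_{\mathrm S\mathrm R},I^{\mathbf p}_{\mathrm S\mathrm R},I^{\mathbf p'\mathbf p}_{\mathrm S\mathrm R}$ and $I_\ast^1,I_\ast^{\mathbf p'},I_\ast^{\mathbf p},I_\ast^{\mathbf p'\mathbf p}$ for the corresponding integrals over the pair $\mathrm S_\ast,\mathrm R_\ast$ (with the same $F,\mathbf p,\mathbf p'$). Then $$I_\ast^1=s(\alpha)\alpha^4I^1,$$ $$I_\ast^{\mathbf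 p'}=s(\alpha)\alpha^5\left(I^{\mathbf p'}+(\mathbf p'\cdot\mathbf t)I^1\right),$$ $$I_\ast^{\mathbf p}=s(\alpha)\alpha^5\left(I^{\mathbf p}+(\mathbf p\cdot\mathbf t)I^1\right),$$ $$I_\ast^{\mathbf p'\mathbf p}=s(\alpha)\alpha^6\left(I^{\mathbf p'\mathbf p}+(\mathbf p\cdot\mathbf t)I^{\mathbf p'}+(\mathbf p'\cdot\mathbf t)I^{\mathbf p}+(\mathbf p\cdot\mathbf t)(\mathbf p'\cdot\mathbf t)I^1\right).$$
   Context: For triangles $A,B\subset\mathbb{R}^3$ (source $A$, receiver $B$), a kernel $F$, and vectors $\mathbf p,\mathbf p'\in\mathbb{R}^3$, with $dS$ denoting surface (area) measure on the relevant triangle, define $$I^1_{AB}=\int_{\mathbf x\in B}\int_{\mathbf x'\in A}F(\mathbf x-\mathbf x')\,dS(\mathbf x')\,dS(\mathbf x),$$ $$I^{\mathbf p'}_{AB}=\int_{\mathbf x\in B}\int_{\mathbf x'\in A}(\mathbf p'\cdot\mathbf x')F(\mathbf x-\mathbf x')\,dS(\mathbf x')\,dS(\mathbf x),$$ $$I^{\mathbf p}_{AB}=\int_{\mathbf x\in B}\int_{\mathbf x'\in A}(\mathbf p\cdot\mathbf x)F(\mathbf x-\mathbf x')\,dS(\mathbf x')\,dS(\mathbf x),$$ $$I^{\mathbf p'\mathbf p}_{AB}=\int_{\mathbf x\in B}\int_{\mathbf x'\in A}(\mathbf p'\cdot\mathbf x')(\mathbf p\cdot\mathbf x)F(\mathbf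 x-\mathbf x')\,dS(\mathbf x')\,dS(\mathbf x).$$ The value of $F$ at $\mathbf 0$ is irrelevant (the set $\mathbf x=\mathbf x'$ has measure zero in $B\times A$). *)

theory Defs
  imports "HOL-Analysis.Analysis"
begin

section \<open>Triangles and their area measure\<close>

definition solid_triangle :: "(real^3) set \<Rightarrow> bool" where
  "solid_triangle T \<longleftrightarrow> (\<exists>a b c. \<not> collinear {a, b, c} \<and> T = convex hull {a, b, c})"

definition plane_chart :: "(real^2 \<Rightarrow> real^3) \<Rightarrow> bool" where
  "plane_chart \<phi> \<longleftrightarrow> (\<forall>u v. dist (\<phi> u) (\<phi> v) = dist u v)"

text \<open>
  The area measure on a planar set \<open>T\<close> is two-dimensional Lebesgue measure, transported to the plane
  of \<open>T\<close> by an isometric chart and restricted to \<open>T\<close>. It is completed, so that measurability on \<open>T\<close>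
  means Lebesgue (not just Borel) measurability. For a triangle such a chart exists
  (\<open>triangle_plane_chart\<close>) and the measure does not depend on which one is taken
  (\<open>area_measure_eq\<close>).
\<close>

definition area_measure :: "(real^3) set \<Rightarrow> (real^3) measure" where
  "area_measure T =
     restrict_space
       (completion (distr lborel borel (SOME \<phi>. plane_chart \<phi> \<and> T \<subseteq> range \<phi>))) T"

lemma plane_chart_linear:
  assumes "plane_chart \<phi>"
  shows "linear (\<lambda>u. \<phi> u - \<phi> 0)" (is "linear ?L")
proof -
  have D: "norm (?L u - ?L v) = norm (u - v)" for u v
    using assms by (simp add: plane_chart_def dist_norm)
  have N: "norm (?L u) = norm u" for u
    using D[of u 0] by simp
  have I: "?L u \<bullet> ?L v = u \<bullet> v" for u v
    unfolding dot_norm_neg by (simp only: D N)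
  have I': "\<phi> u \<bullet> \<phi> v - \<phi> u \<bullet> \<phi> 0 - \<phi> 0 \<bullet> \<phi> v + \<phi> 0 \<bullet> \<phi> 0 = u \<bullet> v" for u v
    using I[of u v] by (simp add: inner_diff_left inner_diff_right)
  show ?thesis
  proof (rule linearI)
    fix u v
    have "(?L (u + v) - (?L u + ?L v)) \<bullet> (?L (u + v) - (?L u + ?L v)) = 0"
      by (simp only: inner_diff_left[of "?L (u + v)"] inner_diff_right[of _ "?L (u + v)"]
          inner_add_left[of "?L u"] inner_add_right[of _ "?L u"] I)
         (simp add: inner_add_left inner_add_right)
    then show "?L (u + v) = ?L u + ?L v" by (simp only: inner_eq_zero_iff right_minus_eq)
  next
    fix r :: real and u
    have "(?L (r *\<^sub>R u) - r *\<^sub>R ?L u) \<bullet> (?L (r *\<^sub>R u) - r *\<^sub>R ?L u) = 0"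
      by (simp only: inner_diff_left[of "?L (r *\<^sub>R u)"] inner_diff_right[of _ "?L (r *\<^sub>R u)"]
          inner_scaleR_left inner_scaleR_right I) simp
    then show "?L (r *\<^sub>R u) = r *\<^sub>R ?L u" by (simp only: inner_eq_zero_iff right_minus_eq)
  qed
qed

lemma plane_chart_inj: "plane_chart \<phi> \<Longrightarrow> inj \<phi>"
  unfolding plane_chart_def inj_def by (metis dist_eq_0_iff)

lemma isometry_measurable:
  fixes f :: "'a::metric_space \<Rightarrow> 'b::metric_space"
  assumes "\<forall>u v. dist (f u) (f v) = dist u v"
  shows "f \<in> borel_measurable borel"
proof -
  have "1-lipschitz_on UNIV f"
    using assms by (auto simp: lipschitz_on_def)
  then show ?thesis
    by (intro borel_measurable_continuous_onI lipschitz_on_continuous_on)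
qed

lemma plane_chart_measurable: "plane_chart \<phi> \<Longrightarrow> \<phi> \<in> borel_measurable borel"
  by (rule isometry_measurable) (simp add: plane_chart_def)

lemma plane_chart_range:
  assumes "plane_chart \<phi>"
  shows "affine (range \<phi>)" "aff_dim (range \<phi>) = 2"
proof -
  let ?L = "\<lambda>u. \<phi> u - \<phi> 0"
  have L: "linear ?L" by (rule plane_chart_linear[OF assms])
  have inj: "inj ?L" using plane_chart_inj[OF assms] by (auto simp: inj_def)
  have eq: "range \<phi> = (+) (\<phi> 0) ` range ?L" by (auto simp: image_iff)
  have "affine (range ?L)"
    by (intro subspace_imp_affine linear_subspace_image[OF L]) auto
  then show "affine (range \<phi>)"
    unfolding eq using affine_translation by blast
  have "aff_dim (range ?L) = 2"
    using aff_dim_injective_linear_image[OF L inj, of UNIV] by simp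
  then show "aff_dim (range \<phi>) = 2"
    unfolding eq aff_dim_translation_eq .
qed

lemma triangle_aff_dim:
  assumes "solid_triangle T"
  shows "aff_dim T = 2"
proof -
  obtain a b c where T: "\<not> collinear {a, b, c}" "T = convex hull {a, b, c}"
    using assms by (auto simp: solid_triangle_def)
  then have "aff_dim T = aff_dim {a, b, c}"
    by (simp add: aff_dim_convex_hull)
  moreover have "aff_dim {a, b, c} > 1"
    using T(1) collinear_aff_dim[of "{a, b, c}"] by simp
  moreover have "aff_dim {a, b, c} \<le> int (card {a, b, c}) - 1"
    by (intro aff_dim_le_card) auto
  moreover have "card {a, b, c} \<le> 3"
    by (simp add: card_insert_if)
  ultimately show ?thesis by linarith
qed

lemma triangle_plane_chart:
  assumes "solid_triangle T"
  shows "\<exists>\<phi>. plane_chart \<phi> \<and> T \<subseteq> range \<phi>"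
proof -
  have "T \<noteq> {}" using triangle_aff_dim[OF assms] by auto
  then obtain a where a: "a \<in> T" by blast
  let ?S = "(\<lambda>x. x - a) ` (affine hull T)"
  have aH: "a \<in> affine hull T" using a by (simp add: hull_inc)
  have S: "subspace ?S"
    using affine_diffs_subspace_subtract[OF _ aH] by simp
  have "aff_dim ?S = 2"
    using triangle_aff_dim[OF assms] by (simp only: aff_dim_translation_eq_subtract aff_dim_affine_hull)
  then have "dim ?S = 2"
    using aff_dim_subspace[OF S] by simp
  then have "dim (UNIV :: (real^2) set) = dim ?S" by simp
  then obtain f :: "real^2 \<Rightarrow> real^3" where f: "linear f" "f ` UNIV = ?S" "\<And>x. norm (f x) = norm x"
    using isometry_subspaces[OF subspace_UNIV S] by (metis UNIV_I)
  have "plane_chart (\<lambda>u. a + f u)"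
    unfolding plane_chart_def dist_norm using f(1,3) by (simp flip: linear_diff[OF f(1)])
  moreover have "T \<subseteq> range (\<lambda>u. a + f u)"
  proof
    fix x assume "x \<in> T"
    then have "x - a \<in> ?S" by (simp add: hull_inc)
    then obtain u where "x - a = f u" using f(2) by blast
    then have "x = a + f u" by (simp add: algebra_simps)
    then show "x \<in> range (\<lambda>u. a + f u)" by blast
  qed
  ultimately show ?thesis by blast
qed

lemma triangle_chart_range:
  assumes "solid_triangle T" "plane_chart \<phi>" "T \<subseteq> range \<phi>"
  shows "range \<phi> = affine hull T"
proof -
  have "affine hull T = affine hull (range \<phi>)"
    using aff_dim_eq_full_gen[OF assms(3)] triangle_aff_dim[OF assms(1)]
      plane_chart_range(2)[OF assms(2)] by simp
  then show ?thesis
    using plane_chart_range(1)[OF assms(2)] by (metis affine_hull_eq)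
qed

lemma lborel_isometry:
  fixes \<theta> :: "real^2 \<Rightarrow> real^2"
  assumes "\<forall>u v. dist (\<theta> u) (\<theta> v) = dist u v"
  shows "distr lborel borel \<theta> = lborel"
proof -
  define c where "c = \<theta> 0"
  define g where "g u = \<theta> u - c" for u
  have g: "orthogonal_transformation g"
    unfolding orthogonal_transformation_isometry g_def c_def using assms by (simp add: dist_norm)
  then obtain h where h: "orthogonal_transformation h" "\<And>x. h (g x) = x" "\<And>x. g (h x) = x"
    using orthogonal_transformation_inv orthogonal_transformation_bij bij_inv_eq_iff by metis
  have m: "f \<in> borel_measurable borel" if "orthogonal_transformation f" for f :: "real^2 \<Rightarrow> real^2"
    using that by (intro borel_measurable_continuous_onI linear_continuous_on
        orthogonal_transformation_linear linear_conv_bounded_linear[THEN iffD1])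
  have "lborel = distr lborel borel g"
  proof (rule lborel_eqI)
    fix l u :: "real^2" assume lu: "\<And>b. b \<in> Basis \<Longrightarrow> l \<bullet> b \<le> u \<bullet> b"
    have v: "g -` box l u = h ` box l u"
    proof (intro equalityI subsetI)
      fix x assume "x \<in> g -` box l u"
      then show "x \<in> h ` box l u" using h(2)[of x] by (metis imageI vimageD)
    next
      fix x assume "x \<in> h ` box l u"
      then show "x \<in> g -` box l u" using h(3) by auto
    qed
    have b: "box l u \<in> lmeasurable" by simp
    have "emeasure (distr lborel borel g) (box l u) = emeasure lborel (g -` box l u)"
      using m[OF g] by (simp add: emeasure_distr)
    also have "\<dots> = emeasure lebesgue (h ` box l u)"
      using measurable_sets[OF m[OF g], of "box l u"] v by simp
    also have "\<dots> = ennreal (measure lebesgue (h ` box l u))"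
      using measurable_orthogonal_image[OF h(1) b] by (simp add: emeasure_eq_measure2)
    also have "\<dots> = ennreal (measure lebesgue (box l u))"
      using measure_orthogonal_image[OF h(1) b] by simp
    also have "\<dots> = emeasure lborel (box l u)"
      using b by (simp add: emeasure_eq_measure2)
    also have "\<dots> = (\<Prod>b\<in>Basis. (u - l) \<bullet> b)"
      using lu by (simp add: emeasure_lborel_box)
    finally show "emeasure (distr lborel borel g) (box l u) = (\<Prod>b\<in>Basis. (u - l) \<bullet> b)" .
  qed simp
  then have "distr lborel borel \<theta> = distr (distr lborel borel g) borel (\<lambda>x. c + x)"
    using m[OF g] by (subst distr_distr) (auto simp: g_def o_def)
  then show ?thesis
    using \<open>lborel = distr lborel borel g\<close> lborel_distr_plus[of c] by simp
qed

lemma area_measure_eq: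
  assumes T: "solid_triangle T" and \<phi>: "plane_chart \<phi>" "T \<subseteq> range \<phi>"
  shows "area_measure T = restrict_space (completion (distr lborel borel \<phi>)) T"
proof -
  define \<psi> where "\<psi> = (SOME \<phi>. plane_chart \<phi> \<and> T \<subseteq> range \<phi>)"
  have \<psi>: "plane_chart \<psi>" "T \<subseteq> range \<psi>"
    using someI_ex[OF triangle_plane_chart[OF T]] by (auto simp: \<psi>_def)
  define \<theta> where "\<theta> u = inv \<psi> (\<phi> u)" for u
  have "range \<phi> = range \<psi>"
    using triangle_chart_range[OF T \<phi>] triangle_chart_range[OF T \<psi>] by simp
  then have c: "\<psi> (\<theta> u) = \<phi> u" for u
    unfolding \<theta>_def by (metis f_inv_into_f rangeI)
  have iso: "\<forall>u v. dist (\<theta> u) (\<theta> v) = dist u v"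
    using c \<phi>(1) \<psi>(1) by (metis plane_chart_def)
  then have "\<theta> \<in> borel_measurable borel"
    by (rule isometry_measurable)
  then have "distr (distr lborel borel \<theta>) borel \<psi> = distr lborel borel \<phi>"
    using plane_chart_measurable[OF \<psi>(1)] c by (subst distr_distr) (auto simp: o_def)
  then have "distr lborel borel \<psi> = distr lborel borel \<phi>"
    by (simp add: lborel_isometry[OF iso])
  then show ?thesis
    by (simp add: area_measure_def flip: \<psi>_def)
qed


section \<open>The four interaction integrals\<close>

text \<open>\<open>A\<close> is the source and \<open>B\<close> the receiver; the inner integral is over the source.
  The kernel is total only for convenience: its value at \<open>0\<close> does not matter, the diagonal being
  a null set.\<close>

definition kernel_integral ::
  "(real^3 \<Rightarrow> complex) \<Rightarrow> (real^3) set \<Rightarrow> (real^3) set \<Rightarrow> complex" where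
  "kernel_integral F A B =
     (LINT x|area_measure B. LINT x'|area_measure A. F (x - x'))"

definition kernel_integral_src ::
  "(real^3 \<Rightarrow> complex) \<Rightarrow> real^3 \<Rightarrow> (real^3) set \<Rightarrow> (real^3) set \<Rightarrow> complex" where
  "kernel_integral_src F p' A B =
     (LINT x|area_measure B. LINT x'|area_measure A.
        complex_of_real (p' \<bullet> x') * F (x - x'))"

definition kernel_integral_rcv ::
  "(real^3 \<Rightarrow> complex) \<Rightarrow> real^3 \<Rightarrow> (real^3) set \<Rightarrow> (real^3) set \<Rightarrow> complex" where
  "kernel_integral_rcv F p A B =
     (LINT x|area_measure B. LINT x'|area_measure A.
        complex_of_real (p \<bullet> x) * F (x - x'))"

definition kernel_integral_src_rcv ::
  "(real^3 \<Rightarrow> complex) \<Rightarrow> real^3 \<Rightarrow> real^3 \<Rightarrow> (real^3) set \<Rightarrow> (real^3) set \<Rightarrow> complex" where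
  "kernel_integral_src_rcv F p' p A B =
     (LINT x|area_measure B. LINT x'|area_measure A.
        complex_of_real (p' \<bullet> x') * complex_of_real (p \<bullet> x) * F (x - x'))"

text \<open>
  The product of the two area measures is completed as well, so integrability (the Bochner
  integrability of the library, hence absolute) is with respect to four-dimensional Lebesgue
  measure on \<open>B \<times> A\<close>.
\<close>

definition kernel_integrable ::
  "(real^3 \<Rightarrow> complex) \<Rightarrow> (real^3) set \<Rightarrow> (real^3) set \<Rightarrow> bool" where
  "kernel_integrable F A B \<longleftrightarrow>
     integrable (completion (area_measure B \<Otimes>\<^sub>M area_measure A)) (\<lambda>(x, x'). F (x - x'))"

end

theory Submission
  imports Defs
begin

text \<open>
  The similarity \<open>\<tau> x = \<alpha> (x + t)\<close> carries an isometric chart \<open>\<phi>\<close> of the plane of a triangle to the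
  isometric chart \<open>u \<mapsto> \<tau> (\<phi> (u / \<alpha>))\<close> of the image plane, so every area integral over the image is
  \<open>\<alpha>\<^sup>2\<close> times the pulled-back integral, and a double integral gains \<open>\<alpha>\<^sup>4\<close>. Since
  \<open>\<tau> x - \<tau> x' = \<alpha> (x - x')\<close>, homogeneity contributes \<open>s \<alpha>\<close> off the null diagonal, and expanding
  \<open>p \<bullet> \<tau> x = \<alpha> (p \<bullet> x + p \<bullet> t)\<close> gives the weighted integrals. Only this expansion uses the
  integrability of the kernel: by Fubini on the completed product, inner and outer integrals are
  additive.
\<close>

section \<open>Completed measures\<close>

text \<open>Preimages of a Borel set under \<open>f\<close> and \<open>g\<close> differ by a null
  set, and completeness makes any set measurable that agrees almost everywhere with a measurable
  one.\<close>

lemma (in complete_measure) borel_measurable_cong_AE: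
  fixes f g :: "'a \<Rightarrow> 'b::topological_space"
  assumes f: "f \<in> borel_measurable M" and eq: "AE x in M. f x = g x"
  shows "g \<in> borel_measurable M"
proof (rule measurableI)
  fix A :: "'b set" assume "A \<in> sets borel"
  then have "f -` A \<inter> space M \<in> sets M"
    using f by (rule measurable_sets[rotated])
  moreover have "AE x in M. x \<in> f -` A \<inter> space M \<longleftrightarrow> x \<in> g -` A \<inter> space M"
    using eq by eventually_elim auto
  ultimately show "g -` A \<inter> space M \<in> sets M"
    using in_sets_AE[of "f -` A \<inter> space M" "g -` A \<inter> space M"] by simp
qed simp

lemma (in complete_measure) integrable_cong_AE_complete:
  fixes f g :: "'a \<Rightarrow> 'b::{banach, second_countable_topology}"
  assumes f: "integrable M f" and eq: "AE x in M. f x = g x"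
  shows "integrable M g" "integral\<^sup>L M g = integral\<^sup>L M f"
proof -
  have "g \<in> borel_measurable M"
    by (rule borel_measurable_cong_AE[OF borel_measurable_integrable[OF f] eq])
  then show "integrable M g" "integral\<^sup>L M g = integral\<^sup>L M f"
    using f eq integrable_cong_AE[of f M g] integral_cong_AE[of f M g] by simp_all
qed

text \<open>Integrability passes in both directions, so if it fails for one function it fails for
  the other, and both integrals take the default value \<open>0\<close>.\<close>

lemma (in complete_measure) integral_cong_AE_complete:
  fixes f g :: "'a \<Rightarrow> 'b::{banach, second_countable_topology}"
  assumes eq: "AE x in M. f x = g x"
  shows "integral\<^sup>L M f = integral\<^sup>L M g"
proof (rule integral_eq_cases)
  have eq': "AE x in M. g x = f x" using eq by (auto elim: eventually_mono)
  show "integrable M f \<longleftrightarrow> integrable M g"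
    using integrable_cong_AE_complete(1)[OF _ eq] integrable_cong_AE_complete(1)[OF _ eq'] by blast
  show "integral\<^sup>L M f = integral\<^sup>L M g" if "integrable M f" "integrable M g"
    using integrable_cong_AE_complete(2)[OF that(1) eq] by simp
qed

text \<open>A null set of the restriction is a null set of \<open>M\<close> inside \<open>A\<close>,
  so completeness of \<open>M\<close> already makes its subsets measurable.\<close>

lemma complete_measure_restrict_space:
  assumes M: "complete_measure M" and A: "A \<in> sets M"
  shows "complete_measure (restrict_space M A)"
proof
  fix B C assume "B \<subseteq> C" "C \<in> null_sets (restrict_space M A)"
  then have "B \<subseteq> A" "B \<in> sets M"
    using complete_measure.complete[OF M] by (auto simp: null_sets_restrict_space[OF A])
  then show "B \<in> sets (restrict_space M A)"
    using sets.Int_space_eq2[OF A] by (auto simp: sets_restrict_space_iff A)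
qed

lemma completion_ex_borel_measurable_complex:
  fixes f :: "'a \<Rightarrow> complex"
  assumes "f \<in> borel_measurable (completion M)"
  shows "\<exists>f'\<in>borel_measurable M. AE x in M. f x = f' x"
proof -
  obtain g where g: "g \<in> borel_measurable M" "AE x in M. Re (f x) = g x"
    using completion_ex_borel_measurable_real[of "\<lambda>x. Re (f x)" M] assms by auto
  obtain h where h: "h \<in> borel_measurable M" "AE x in M. Im (f x) = h x"
    using completion_ex_borel_measurable_real[of "\<lambda>x. Im (f x)" M] assms by auto
  have "AE x in M. f x = Complex (g x) (h x)"
    using g(2) h(2) by eventually_elim (simp add: complex_eq_iff)
  moreover have "(\<lambda>x. Complex (g x) (h x)) \<in> borel_measurable M"
    using g(1) h(1) by (simp add: Complex_eq)
  ultimately show ?thesis by (rule bexI[where x = "\<lambda>x. Complex (g x) (h x)"])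
qed

text \<open>Fubini for a Lebesgue measurable \<open>f\<close>: a product-measurable version
  \<open>g\<close> differs from it on a null set, almost every slice of which is null. Completeness
  of \<open>N\<close> then carries integrability from the slices of \<open>g\<close> to those of
  \<open>f\<close>, and completeness of \<open>M\<close> does the same for the outer
  function.\<close>

lemma integrable_completion_pair:
  fixes f :: "'a \<times> 'b \<Rightarrow> complex"
  assumes "pair_sigma_finite M N" and M: "complete_measure M" and N: "complete_measure N"
    and f: "integrable (completion (M \<Otimes>\<^sub>M N)) f"
  shows "AE x in M. integrable N (\<lambda>y. f (x, y))"
    and "integrable M (\<lambda>x. \<integral>y. f (x, y) \<partial>N)"
proof -
  interpret pair_sigma_finite M N by fact
  obtain g where g: "g \<in> borel_measurable (M \<Otimes>\<^sub>M N)" "AE z in M \<Otimes>\<^sub>M N. f z = g z"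
    using completion_ex_borel_measurable_complex[OF borel_measurable_integrable[OF f]] by blast
  \<comment> \<open>\<open>g\<close> inherits integrability from \<open>f\<close> on the completed
    product; being measurable for the product itself, it is integrable there too, where ordinary
    Fubini applies.\<close>
  have "integrable (completion (M \<Otimes>\<^sub>M N)) g"
    using g f by (intro integrable_cong_AE_imp[OF f] measurable_completion)
      (auto simp: AE_completion_iff elim: eventually_mono)
  then have ig: "integrable (M \<Otimes>\<^sub>M N) g"
    using g(1) integrable_completion by blast
  have eq: "AE x in M. integrable N (\<lambda>y. f (x, y)) \<and> (\<integral>y. f (x, y) \<partial>N) = (\<integral>y. g (x, y) \<partial>N)"
    using AE_pair[OF g(2)] AE_integrable_fst'[OF ig]
  proof eventually_elim
    case (elim x)
    then have "AE y in N. g (x, y) = f (x, y)"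
      by (auto elim: eventually_mono)
    from complete_measure.integrable_cong_AE_complete[OF N elim(2) this]
    show ?case by simp
  qed
  then show "AE x in M. integrable N (\<lambda>y. f (x, y))"
    by eventually_elim simp
  have "AE x in M. (\<integral>y. g (x, y) \<partial>N) = (\<integral>y. f (x, y) \<partial>N)"
    using eq by eventually_elim simp
  then show "integrable M (\<lambda>x. \<integral>y. f (x, y) \<partial>N)"
    by (rule complete_measure.integrable_cong_AE_complete(1)[OF M integrable_fst'[OF ig]])
qed

text \<open>In contrast to \<open>integral_distr\<close>, the integrand need not be measurable: both sides are then \<open>0\<close>.\<close>
lemma integral_distr_bimeasurable:
  fixes g :: "'b \<Rightarrow> 'c::{banach, second_countable_topology}"
  assumes h: "h \<in> measurable M N" and k: "k \<in> measurable N M"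
    and inv: "\<And>y. y \<in> space N \<Longrightarrow> h (k y) = y"
  shows "integral\<^sup>L (distr M N h) g = (\<integral>x. g (h x) \<partial>M)"
proof (cases "g \<in> borel_measurable N")
  case True
  then show ?thesis by (rule integral_distr[OF h])
next
  case False
  \<comment> \<open>On the space of \<open>N\<close>, \<open>g\<close> is recovered as
    \<open>g \<circ> h \<circ> k\<close>, so measurability of \<open>g \<circ> h\<close> would give
    that of \<open>g\<close>.\<close>
  have "(\<lambda>x. g (h x)) \<notin> borel_measurable M"
  proof
    assume "(\<lambda>x. g (h x)) \<in> borel_measurable M"
    from measurable_compose[OF k this] have "(\<lambda>y. g (h (k y))) \<in> borel_measurable N" .
    also have "?this \<longleftrightarrow> g \<in> borel_measurable N"
      by (intro measurable_cong) (simp add: inv)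
    finally show False using False by simp
  qed
  then have "\<not> integrable M (\<lambda>x. g (h x))" "\<not> integrable (distr M N h) g"
    using False by auto
  then show ?thesis by (simp add: not_integrable_integral_eq)
qed

text \<open>The density keeps the measurable sets, so for non-measurable \<open>g\<close> both
  integrals are \<open>0\<close>.\<close>

lemma integral_density_const:
  fixes g :: "'a \<Rightarrow> 'b::{banach, second_countable_topology}"
  assumes "c > 0"
  shows "integral\<^sup>L (density M (\<lambda>_. ennreal c)) g = c *\<^sub>R integral\<^sup>L M g"
proof (cases "g \<in> borel_measurable M")
  case True
  then show ?thesis using assms by (subst integral_density) auto
next
  case False
  then have "\<not> integrable M g" "\<not> integrable (density M (\<lambda>_. ennreal c)) g" by auto
  then show ?thesis by (simp add: not_integrable_integral_eq)
qed

section \<open>Similarities of the plane of a triangle\<close>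

text \<open>Lebesgue measure of the whole plane before completion; completed and restricted to a
  triangle it becomes \<open>area_measure\<close>.\<close>

definition chart_measure :: "(real^2 \<Rightarrow> real^3) \<Rightarrow> (real^3) measure" where
  "chart_measure \<phi> = distr lborel borel \<phi>"

lemma sets_chart_measure [simp, measurable_cong]: "sets (chart_measure \<phi>) = sets borel"
  and space_chart_measure [simp]: "space (chart_measure \<phi>) = UNIV"
  by (simp_all add: chart_measure_def)

text \<open>The map is a parameter with an equation, so that its inverse, again of this form, can be
  a second instance.\<close>

locale similarity =
  fixes \<alpha> :: real and t :: "real^3" and \<tau> :: "real^3 \<Rightarrow> real^3"
  assumes nonzero: "\<alpha> \<noteq> 0" and \<tau>_eq: "\<And>x. \<tau> x = \<alpha> *\<^sub>R (x + t)"
begin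

lemma measurable_\<tau> [measurable]: "\<tau> \<in> borel_measurable borel"
proof -
  have "\<tau> = (\<lambda>x. \<alpha> *\<^sub>R (x + t))" by (simp add: fun_eq_iff \<tau>_eq)
  then show ?thesis by simp
qed

text \<open>Shrinking the parameter by \<open>1 / \<alpha>\<close> undoes the factor |\<alpha>| by
  which \<open>\<tau>\<close> stretches distances.\<close>

lemma plane_chart_transport:
  assumes "plane_chart \<phi>"
  shows "plane_chart (\<lambda>u. \<tau> (\<phi> ((1 / \<alpha>) *\<^sub>R u)))"
  unfolding plane_chart_def
proof safe
  fix u v
  have "dist (\<tau> (\<phi> ((1/\<alpha>) *\<^sub>R u))) (\<tau> (\<phi> ((1/\<alpha>) *\<^sub>R v)))
      = \<bar>\<alpha>\<bar> * dist (\<phi> ((1/\<alpha>) *\<^sub>R u)) (\<phi> ((1/\<alpha>) *\<^sub>R v))"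
    by (simp add: \<tau>_eq dist_norm flip: scaleR_diff_right)
  also have "\<dots> = \<bar>\<alpha>\<bar> * dist ((1/\<alpha>) *\<^sub>R u) ((1/\<alpha>) *\<^sub>R v)"
    using assms by (simp add: plane_chart_def)
  also have "\<dots> = dist u v"
    using nonzero by (simp add: dist_norm flip: scaleR_diff_right)
  finally show "dist (\<tau> (\<phi> ((1/\<alpha>) *\<^sub>R u))) (\<tau> (\<phi> ((1/\<alpha>) *\<^sub>R v))) = dist u v" .
qed

text \<open>Lebesgue measure of the plane is \<open>\<alpha>\<^sup>2\<close> times its image under
  \<open>u \<mapsto> \<alpha> u\<close>; inserting this image on the left cancels the
  \<open>1 / \<alpha>\<close> in the chart.\<close>

lemma chart_measure_transport:
  assumes \<phi>: "plane_chart \<phi>"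
  shows "chart_measure (\<lambda>u. \<tau> (\<phi> ((1 / \<alpha>) *\<^sub>R u)))
    = density (distr (chart_measure \<phi>) borel \<tau>) (\<lambda>_. ennreal (\<alpha>\<^sup>2))"
proof -
  note [measurable] = plane_chart_measurable[OF \<phi>]
  have "chart_measure (\<lambda>u. \<tau> (\<phi> ((1 / \<alpha>) *\<^sub>R u)))
      = distr (density (distr lborel borel (\<lambda>u. 0 + \<alpha> *\<^sub>R u)) (\<lambda>_. ennreal (\<bar>\<alpha>\<bar> ^ DIM(real^2)))) borel
          (\<lambda>u. \<tau> (\<phi> ((1 / \<alpha>) *\<^sub>R u)))"
    unfolding chart_measure_def by (subst lborel_affine[OF nonzero, of 0]) simp
  also have "\<dots> = density (distr (distr lborel borel (\<lambda>u. 0 + \<alpha> *\<^sub>R u)) borel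
          (\<lambda>u. \<tau> (\<phi> ((1 / \<alpha>) *\<^sub>R u)))) (\<lambda>_. ennreal (\<bar>\<alpha>\<bar> ^ DIM(real^2)))"
    by (subst density_distr) auto
  also have "\<dots> = density (distr (chart_measure \<phi>) borel \<tau>) (\<lambda>_. ennreal (\<alpha>\<^sup>2))"
    using nonzero by (simp add: chart_measure_def distr_distr o_def)
  finally show ?thesis .
qed

lemma null_sets_chart_measure_transport:
  assumes "plane_chart \<phi>"
  shows "null_sets (distr (chart_measure \<phi>) borel \<tau>)
    = null_sets (chart_measure (\<lambda>u. \<tau> (\<phi> ((1 / \<alpha>) *\<^sub>R u))))"
  using nonzero
  by (auto simp: chart_measure_transport[OF assms] null_sets_def emeasure_density_const)

text \<open>Completion commutes with the image under \<open>\<tau>\<close> because the image measure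
  and the target have the same null sets, and with the density because it is a positive
  constant.\<close>

lemma completion_chart_measure_transport:
  fixes \<phi> defines "\<phi>' \<equiv> \<lambda>u. \<tau> (\<phi> ((1 / \<alpha>) *\<^sub>R u))"
  assumes \<phi>: "plane_chart \<phi>"
  shows "\<tau> \<in> measurable (completion (chart_measure \<phi>)) (completion (chart_measure \<phi>'))"
    and "completion (chart_measure \<phi>') = density
      (distr (completion (chart_measure \<phi>)) (completion (chart_measure \<phi>')) \<tau>) (\<lambda>_. ennreal (\<alpha>\<^sup>2))"
proof -
  have m: "\<tau> \<in> measurable (completion (chart_measure \<phi>)) (chart_measure \<phi>')"
    by (intro measurable_completion) measurable
  have d: "distr (completion (chart_measure \<phi>)) (chart_measure \<phi>') \<tau> = distr (chart_measure \<phi>) borel \<tau>"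
    by (subst distr_completion) (auto intro: distr_cong)
  have null: "null_sets (distr (completion (chart_measure \<phi>)) (chart_measure \<phi>') \<tau>)
      = null_sets (chart_measure \<phi>')"
    by (simp only: d) (simp only: \<phi>'_def null_sets_chart_measure_transport[OF \<phi>])
  show "\<tau> \<in> measurable (completion (chart_measure \<phi>)) (completion (chart_measure \<phi>'))"
    by (rule completion.measurable_completion2[OF m]) (simp add: null)
  have "completion (chart_measure \<phi>') = completion
      (density (distr (completion (chart_measure \<phi>)) (chart_measure \<phi>') \<tau>) (\<lambda>_. ennreal (\<alpha>\<^sup>2)))"
    by (simp only: d) (simp add: \<phi>'_def chart_measure_transport[OF \<phi>])
  also have "\<dots> = density
      (completion (distr (completion (chart_measure \<phi>)) (chart_measure \<phi>') \<tau>)) (\<lambda>_. ennreal (\<alpha>\<^sup>2))"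
    using nonzero by (intro completion_density_eq) auto
  also have "\<dots> = density
      (distr (completion (chart_measure \<phi>)) (completion (chart_measure \<phi>')) \<tau>) (\<lambda>_. ennreal (\<alpha>\<^sup>2))"
    by (simp only: completion.completion_distr_eq[OF m null])
  finally show "completion (chart_measure \<phi>') = \<dots>" .
qed

text \<open>Scaling and translation commute with convex hulls and, since \<alpha> is nonzero,
  preserve affine dimension, which detects collinearity.\<close>

lemma solid_triangle_image:
  assumes "solid_triangle T"
  shows "solid_triangle (\<tau> ` T)"
proof -
  obtain a b c where T: "\<not> collinear {a, b, c}" "T = convex hull {a, b, c}"
    using assms by (auto simp: solid_triangle_def)
  have im: "\<tau> ` A = (+) (\<alpha> *\<^sub>R t) ` ((*\<^sub>R) \<alpha> ` A)" for A
    by (auto simp: \<tau>_eq image_image scaleR_add_right add.commute)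
  have "\<tau> ` T = convex hull {\<tau> a, \<tau> b, \<tau> c}"
    unfolding T(2) im convex_hull_scaling[symmetric] convex_hull_translation[symmetric]
    by (simp add: \<tau>_eq scaleR_add_right add.commute)
  moreover have "\<not> collinear {\<tau> a, \<tau> b, \<tau> c}"
  proof -
    have "aff_dim (\<tau> ` {a, b, c}) = aff_dim {a, b, c}"
      unfolding im aff_dim_translation_eq
      by (intro aff_dim_injective_linear_image linear_scale_self) (simp add: inj_on_def nonzero)
    then show ?thesis using T(1) by (simp add: collinear_aff_dim)
  qed
  ultimately show ?thesis unfolding solid_triangle_def by blast
qed

end

lemma compact_solid_triangle: "solid_triangle T \<Longrightarrow> compact T"
  by (auto simp: solid_triangle_def intro: finite_imp_compact_convex_hull)

lemma area_measure_chartE: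
  assumes "solid_triangle T"
  obtains \<phi> where "plane_chart \<phi>" "T \<subseteq> range \<phi>"
    "area_measure T = restrict_space (completion (chart_measure \<phi>)) T"
  using triangle_plane_chart[OF assms] area_measure_eq[OF assms] unfolding chart_measure_def by blast

context similarity
begin

text \<open>Change of variables for an arbitrary \<open>g\<close>: \<open>\<tau>\<close> and its
  inverse are both measurable between the completions, so measurability of \<open>g\<close> and of
  \<open>g \<circ> \<tau>\<close> stand or fall together.\<close>

lemma integral_area_measure_image:
  fixes g :: "real^3 \<Rightarrow> complex"
  assumes T: "solid_triangle T"
  shows "integral\<^sup>L (area_measure (\<tau> ` T)) g = \<alpha>\<^sup>2 *\<^sub>R (\<integral>x. g (\<tau> x) \<partial>area_measure T)"
proof -
  obtain \<phi> where \<phi>: "plane_chart \<phi>" "T \<subseteq> range \<phi>"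
    and T_eq: "area_measure T = restrict_space (completion (chart_measure \<phi>)) T"
    using area_measure_chartE[OF T] .
  define \<phi>' where "\<phi>' = (\<lambda>u. \<tau> (\<phi> ((1 / \<alpha>) *\<^sub>R u)))"
  \<comment> \<open>The inverse of \<open>\<tau>\<close>, written as a similarity of ratio
    \<open>1 / \<alpha>\<close> with shift \<open>- (\<alpha> *\<^sub>R t)\<close>.\<close>
  define \<sigma> where "\<sigma> y = (1 / \<alpha>) *\<^sub>R (y + - (\<alpha> *\<^sub>R t))" for y
  have \<sigma>\<tau>: "\<sigma> (\<tau> x) = x" and \<tau>\<sigma>: "\<tau> (\<sigma> x) = x" for x
    using nonzero by (simp_all add: \<sigma>_def \<tau>_eq algebra_simps)
  interpret inverse_sim: similarity "1 / \<alpha>" "- (\<alpha> *\<^sub>R t)" \<sigma>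
    using nonzero by unfold_locales (simp_all add: \<sigma>_def)
  have \<phi>': "plane_chart \<phi>'"
    unfolding \<phi>'_def by (rule plane_chart_transport[OF \<phi>(1)])
  have ran: "\<tau> ` T \<subseteq> range \<phi>'"
  proof
    fix y assume "y \<in> \<tau> ` T"
    then obtain u where "y = \<tau> (\<phi> u)" using \<phi>(2) by blast
    then have "y = \<phi>' (\<alpha> *\<^sub>R u)" using nonzero by (simp add: \<phi>'_def)
    then show "y \<in> range \<phi>'" by blast
  qed
  \<comment> \<open>Transporting \<open>\<phi>'\<close> back along the inverse restores the original
    chart, so the lemma just used for \<open>\<tau>\<close> also yields measurability of
    \<open>\<sigma>\<close>.\<close>
  have back_eq: "(\<lambda>u. \<sigma> (\<phi>' ((1 / (1 / \<alpha>)) *\<^sub>R u))) = \<phi>"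
    using nonzero by (simp add: \<phi>'_def \<sigma>\<tau>)
  have m\<tau>: "\<tau> \<in> measurable (completion (chart_measure \<phi>)) (completion (chart_measure \<phi>'))"
    unfolding \<phi>'_def by (rule completion_chart_measure_transport[OF \<phi>(1)])
  have m\<sigma>: "\<sigma> \<in> measurable (completion (chart_measure \<phi>')) (completion (chart_measure \<phi>))"
    using inverse_sim.completion_chart_measure_transport(1)[OF \<phi>'] unfolding back_eq .
  have dens: "completion (chart_measure \<phi>') = density
      (distr (completion (chart_measure \<phi>)) (completion (chart_measure \<phi>')) \<tau>) (\<lambda>_. ennreal (\<alpha>\<^sup>2))"
    unfolding \<phi>'_def by (rule completion_chart_measure_transport[OF \<phi>(1)])
  have bT: "T \<in> sets borel" "\<tau> ` T \<in> sets borel"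
    using T solid_triangle_image[OF T] by (auto intro!: borel_compact compact_solid_triangle)
  have ind: "indicator (\<tau> ` T) (\<tau> x) = (indicator T x :: real)" for x
    by (auto simp: indicator_def image_iff) (metis \<sigma>\<tau>)
  have "integral\<^sup>L (area_measure (\<tau> ` T)) g
      = integral\<^sup>L (restrict_space (completion (chart_measure \<phi>')) (\<tau> ` T)) g"
    using area_measure_eq[OF solid_triangle_image[OF T] \<phi>' ran] by (simp add: chart_measure_def)
  also have "\<dots> = (\<integral>y. indicator (\<tau> ` T) y *\<^sub>R g y \<partial>completion (chart_measure \<phi>'))"
    using bT by (intro integral_restrict_space) auto
  also have "\<dots> = \<alpha>\<^sup>2 *\<^sub>R (\<integral>y. indicator (\<tau> ` T) y *\<^sub>R g y
      \<partial>distr (completion (chart_measure \<phi>)) (completion (chart_measure \<phi>')) \<tau>)"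
    using nonzero by (subst dens) (simp add: integral_density_const)
  also have "\<dots> = \<alpha>\<^sup>2 *\<^sub>R (\<integral>x. indicator (\<tau> ` T) (\<tau> x) *\<^sub>R g (\<tau> x) \<partial>completion (chart_measure \<phi>))"
    by (subst integral_distr_bimeasurable[OF m\<tau> m\<sigma>]) (simp_all add: \<tau>\<sigma>)
  also have "\<dots> = \<alpha>\<^sup>2 *\<^sub>R (\<integral>x. indicator T x *\<^sub>R g (\<tau> x) \<partial>completion (chart_measure \<phi>))"
    by (simp only: ind)
  also have "(\<integral>x. indicator T x *\<^sub>R g (\<tau> x) \<partial>completion (chart_measure \<phi>)) = (\<integral>x. g (\<tau> x) \<partial>area_measure T)"
    unfolding T_eq using bT by (intro integral_restrict_space[symmetric]) auto
  finally show ?thesis .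
qed

end

section \<open>Completeness, finiteness and null points of the area measure\<close>

lemma space_area_measure:
  assumes "solid_triangle T" shows "space (area_measure T) = T"
  by (rule area_measure_chartE[OF assms]) (simp add: space_restrict_space)

lemma measurable_ident_area_measure:
  assumes "solid_triangle T" shows "(\<lambda>x. x) \<in> borel_measurable (area_measure T)"
  by (rule area_measure_chartE[OF assms])
    (simp add: measurable_restrict_space1 measurable_completion)

lemma complete_area_measure:
  assumes "solid_triangle T" shows "complete_measure (area_measure T)"
  by (rule area_measure_chartE[OF assms])
    (use compact_solid_triangle[OF assms] in \<open>auto intro!: complete_measure_restrict_space
      completion.complete_measure_axioms borel_compact\<close>)

text \<open>An isometric chart pulls the bounded triangle back to a bounded set, which has finite
  Lebesgue measure.\<close>

lemma finite_area_measure: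
  assumes T: "solid_triangle T" shows "finite_measure (area_measure T)"
proof (rule area_measure_chartE[OF T])
  fix \<phi> assume \<phi>: "plane_chart \<phi>" "T \<subseteq> range \<phi>"
    and eq: "area_measure T = restrict_space (completion (chart_measure \<phi>)) T"
  have bT: "T \<in> sets borel"
    using T by (auto intro!: borel_compact compact_solid_triangle)
  have "bounded (\<phi> -` T)"
  proof -
    obtain C where C: "\<And>x y. x \<in> T \<Longrightarrow> y \<in> T \<Longrightarrow> dist x y \<le> C"
      using compact_imp_bounded[OF compact_solid_triangle[OF T]] bounded_two_points by metis
    then have "\<forall>u\<in>\<phi> -` T. \<forall>v\<in>\<phi> -` T. dist u v \<le> C"
      using \<phi>(1) by (auto simp: plane_chart_def) metis
    then show ?thesis using bounded_two_points by metis
  qed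
  then have "emeasure lborel (\<phi> -` T) \<noteq> \<infinity>"
    using emeasure_bounded_finite by (metis infinity_ennreal_def less_irrefl)
  then show ?thesis
    unfolding eq using bT plane_chart_measurable[OF \<phi>(1)]
    by (intro finite_measureI)
      (simp add: space_restrict_space emeasure_restrict_space chart_measure_def emeasure_distr)
qed

text \<open>An injective chart meets \<open>x\<close> in at most one parameter. This removes the
  diagonal, where homogeneity says nothing.\<close>

lemma AE_area_measure_neq:
  assumes T: "solid_triangle T" shows "AE y in area_measure T. y \<noteq> x"
proof (rule area_measure_chartE[OF T])
  fix \<phi> assume \<phi>: "plane_chart \<phi>" "T \<subseteq> range \<phi>"
    and eq: "area_measure T = restrict_space (completion (chart_measure \<phi>)) T"
  have bT: "T \<in> sets borel"
    using T by (auto intro!: borel_compact compact_solid_triangle)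
  have "finite (\<phi> -` {x})"
    using plane_chart_inj[OF \<phi>(1)] by (intro finite_vimageI) auto
  then have "AE u in lborel. u \<notin> \<phi> -` {x}"
    by (intro AE_not_in) (auto intro: finite_imp_null_set_lborel)
  then have "AE y in chart_measure \<phi>. y \<noteq> x"
    unfolding chart_measure_def using plane_chart_measurable[OF \<phi>(1)]
    by (subst AE_distr_iff) auto
  then have "AE y in completion (chart_measure \<phi>). y \<noteq> x"
    by (rule AE_completion)
  then show ?thesis
    unfolding eq using bT by (subst AE_restrict_space_iff) (auto elim: eventually_mono)
qed

section \<open>Weighted kernels\<close>

lemma bounded_inner_solid_triangle:
  fixes p :: "real^3"
  assumes "solid_triangle T"
  obtains C where "\<And>x. x \<in> T \<Longrightarrow> \<bar>p \<bullet> x\<bar> \<le> C"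
proof -
  obtain B where B: "\<And>x. x \<in> T \<Longrightarrow> norm x \<le> B"
    using compact_imp_bounded[OF compact_solid_triangle[OF assms]] by (auto simp: bounded_iff)
  have "\<bar>p \<bullet> x\<bar> \<le> norm p * \<bar>B\<bar>" if "x \<in> T" for x
    using B[OF that] by (intro order_trans[OF Cauchy_Schwarz_ineq2] mult_left_mono) auto
  then show ?thesis by (intro that[of "norm p * \<bar>B\<bar>"]) auto
qed

text \<open>Linear weights are bounded on compact triangles, so a multiple of the norm of
  \<open>K\<close> dominates. A general \<open>K\<close> lets weights be applied in
  succession.\<close>

lemma kernel_weighted_integrable:
  assumes S: "solid_triangle S" and R: "solid_triangle R"
    and F: "integrable (completion (area_measure R \<Otimes>\<^sub>M area_measure S)) (\<lambda>(x, x'). K x x')"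
  shows "integrable (completion (area_measure R \<Otimes>\<^sub>M area_measure S))
      (\<lambda>(x, x'). complex_of_real (p \<bullet> x) * K x x')" (is ?rcv)
    and "integrable (completion (area_measure R \<Otimes>\<^sub>M area_measure S))
      (\<lambda>(x, x'). complex_of_real (p \<bullet> x') * K x x')" (is ?src)
proof -
  let ?P = "area_measure R \<Otimes>\<^sub>M area_measure S"
  note [measurable] = measurable_ident_area_measure[OF S] measurable_ident_area_measure[OF R]
  have bound: "integrable (completion ?P) (\<lambda>z. complex_of_real (w z) * (\<lambda>(x, x'). K x x') z)"
    if w: "w \<in> borel_measurable ?P" and C: "\<And>z. z \<in> R \<times> S \<Longrightarrow> \<bar>w z\<bar> \<le> C" for w C
  proof (rule Bochner_Integration.integrable_bound)
    show "integrable (completion ?P) (\<lambda>z. C * norm ((\<lambda>(x, x'). K x x') z))"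
      using F by (intro integrable_mult_right integrable_norm)
    show "(\<lambda>z. complex_of_real (w z) * (\<lambda>(x, x'). K x x') z) \<in> borel_measurable (completion ?P)"
      using F measurable_completion[OF w]
      by (intro borel_measurable_times borel_measurable_of_real) auto
    show "AE z in completion ?P. norm (complex_of_real (w z) * (\<lambda>(x, x'). K x x') z)
        \<le> norm (C * norm ((\<lambda>(x, x'). K x x') z))"
    proof (rule AE_I2)
      fix z assume "z \<in> space (completion ?P)"
      then have "\<bar>w z\<bar> \<le> \<bar>C\<bar>"
        using C[of z] by (simp add: space_pair_measure space_area_measure S R)
      then show "norm (complex_of_real (w z) * (\<lambda>(x, x'). K x x') z)
        \<le> norm (C * norm ((\<lambda>(x, x'). K x x') z))"
        by (simp add: norm_mult abs_mult mult_right_mono)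
    qed
  qed
  obtain C where C: "\<And>x. x \<in> R \<Longrightarrow> \<bar>p \<bullet> x\<bar> \<le> C" using bounded_inner_solid_triangle[OF R, of p] by blast
  have "(\<lambda>z. p \<bullet> fst z) \<in> borel_measurable ?P" by measurable
  from bound[OF this, of C] C show ?rcv by (auto simp: case_prod_unfold)
  obtain D where D: "\<And>x. x \<in> S \<Longrightarrow> \<bar>p \<bullet> x\<bar> \<le> D" using bounded_inner_solid_triangle[OF S, of p] by blast
  have "(\<lambda>z. p \<bullet> snd z) \<in> borel_measurable ?P" by measurable
  from bound[OF this, of D] D show ?src by (auto simp: case_prod_unfold)
qed

section \<open>Transport of the double integrals and expansion of the weights\<close>

theorem theorem1:
  fixes F :: "real^3 \<Rightarrow> complex" and s :: "real \<Rightarrow> complex"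
    and S R S' R' :: "(real^3) set" and p p' t :: "real^3" and \<alpha> :: real
  assumes homogeneous: "\<And>\<beta> r. \<beta> \<noteq> 0 \<Longrightarrow> r \<noteq> 0 \<Longrightarrow> F (\<beta> *\<^sub>R r) = s \<beta> * F r"
    and "solid_triangle S" and "solid_triangle R"
    and "kernel_integrable F S R"
    and "\<alpha> \<noteq> 0"
    and "S' = (\<lambda>x'. \<alpha> *\<^sub>R (x' + t)) ` S"
    and "R' = (\<lambda>x. \<alpha> *\<^sub>R (x + t)) ` R"
  shows "kernel_integral F S' R' = s \<alpha> * complex_of_real (\<alpha> ^ 4) * kernel_integral F S R \<and>
    kernel_integral_src F p' S' R' =
           s \<alpha> * complex_of_real (\<alpha> ^ 5) *
             (kernel_integral_src F p' S R + complex_of_real (p' \<bullet> t) * kernel_integral F S R) \<and>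
    kernel_integral_rcv F p S' R' =
           s \<alpha> * complex_of_real (\<alpha> ^ 5) *
             (kernel_integral_rcv F p S R + complex_of_real (p \<bullet> t) * kernel_integral F S R) \<and>
    kernel_integral_src_rcv F p' p S' R' =
           s \<alpha> * complex_of_real (\<alpha> ^ 6) *
             (kernel_integral_src_rcv F p' p S R
              + complex_of_real (p \<bullet> t) * kernel_integral_src F p' S R
              + complex_of_real (p' \<bullet> t) * kernel_integral_rcv F p S R
              + complex_of_real (p \<bullet> t) * complex_of_real (p' \<bullet> t) * kernel_integral F S R)"
proof -
  note S = assms(2) and R = assms(3)
  define \<tau> where "\<tau> x = \<alpha> *\<^sub>R (x + t)" for x
  interpret similarity \<alpha> t \<tau>
    using assms(5) by unfold_locales (simp_all add: \<tau>_def)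
  have S': "S' = \<tau> ` S" and R': "R' = \<tau> ` R"
    using assms(6,7) by (simp_all add: \<tau>_def)
  define J where "J K = (LINT x|area_measure R. LINT x'|area_measure S. K x x')"
    for K :: "real^3 \<Rightarrow> real^3 \<Rightarrow> complex"
  define F0 where "F0 x x' = F (x - x')" for x x'
  define Fs where "Fs x x' = complex_of_real (p' \<bullet> x') * F0 x x'" for x x'
  define Fr where "Fr x x' = complex_of_real (p \<bullet> x) * F0 x x'" for x x'
  \<comment> \<open>Built on \<open>Fs\<close>, so that its integrability comes from weighting
    twice.\<close>
  define Fsr where "Fsr x x' = complex_of_real (p \<bullet> x) * Fs x x'" for x x'

  \<comment> \<open>The weight \<open>w\<close> stays arbitrary, so that all four integrals are
    instances.\<close>
  have transport: "(LINT x|area_measure R'. LINT x'|area_measure S'. w x x' * F (x - x'))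
      = s \<alpha> * complex_of_real (\<alpha> ^ 4) * J (\<lambda>x x'. w (\<tau> x) (\<tau> x') * F0 x x')"
    for w :: "real^3 \<Rightarrow> real^3 \<Rightarrow> complex"
  proof -
    have inner: "(LINT x'|area_measure S. w (\<tau> x) (\<tau> x') * F (\<tau> x - \<tau> x'))
        = s \<alpha> * (LINT x'|area_measure S. w (\<tau> x) (\<tau> x') * F0 x x')" for x
    proof -
      have "AE x' in area_measure S. w (\<tau> x) (\<tau> x') * F (\<tau> x - \<tau> x')
          = s \<alpha> * (w (\<tau> x) (\<tau> x') * F0 x x')"
        using AE_area_measure_neq[OF S, of x]
      proof eventually_elim
        case (elim x')
        have "\<tau> x - \<tau> x' = \<alpha> *\<^sub>R (x - x')"
          by (simp add: \<tau>_def algebra_simps)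
        then show ?case
          using elim homogeneous[OF assms(5), of "x - x'"] by (simp add: F0_def)
      qed
      then show ?thesis
        by (simp add: complete_area_measure[OF S, THEN complete_measure.integral_cong_AE_complete]
            flip: integral_mult_right_zero)
    qed
    \<comment> \<open>Each of the two surfaces contributes one factor
      \<open>\<alpha>\<^sup>2\<close>.\<close>
    have "(LINT x|area_measure R'. LINT x'|area_measure S'. w x x' * F (x - x'))
        = \<alpha>\<^sup>2 *\<^sub>R (\<alpha>\<^sup>2 *\<^sub>R (s \<alpha> * J (\<lambda>x x'. w (\<tau> x) (\<tau> x') * F0 x x')))"
      by (simp add: S' R' integral_area_measure_image S R inner J_def)
    then show ?thesis
      by (simp add: scaleR_conv_of_real power2_eq_square power4_eq_xxxx mult_ac)
  qed

  \<comment> \<open>The kernels on which the iterated integral \<open>J\<close> is additive: by itself, convergence of the outer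
    integral says nothing about the inner ones, whose value is \<open>0\<close> where they diverge.\<close>
  define good where "good K \<longleftrightarrow>
      (AE x in area_measure R. integrable (area_measure S) (K x)) \<and>
      integrable (area_measure R) (\<lambda>x. LINT x'|area_measure S. K x x')"
    for K :: "real^3 \<Rightarrow> real^3 \<Rightarrow> complex"
  have pair: "pair_sigma_finite (area_measure R) (area_measure S)"
    unfolding pair_sigma_finite_def
    using finite_area_measure[OF R] finite_area_measure[OF S] by (simp add: finite_measure_def)
  have goodI: "good K" if "integrable (completion (area_measure R \<Otimes>\<^sub>M area_measure S)) (\<lambda>(x, x'). K x x')" for K
    unfolding good_def
    using integrable_completion_pair[OF pair complete_area_measure[OF R] complete_area_measure[OF S] that]
    by simp
  \<comment> \<open>For almost every \<open>x\<close> both inner integrals converge and hence add;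
    completeness of the outer measure carries this almost-everywhere identity to the outer
    integral.\<close>
  have add: "good (\<lambda>x x'. K x x' + L x x')" "J (\<lambda>x x'. K x x' + L x x') = J K + J L"
    if "good K" "good L" for K L
  proof -
    have ae: "AE x in area_measure R. (LINT x'|area_measure S. K x x') + (LINT x'|area_measure S. L x x')
        = (LINT x'|area_measure S. K x x' + L x x')"
      and ae': "AE x in area_measure R. integrable (area_measure S) (\<lambda>x'. K x x' + L x x')"
      using that unfolding good_def by auto
    have i: "integrable (area_measure R) (\<lambda>x. (LINT x'|area_measure S. K x x') + (LINT x'|area_measure S. L x x'))"
      using that unfolding good_def by auto
    note c = complete_measure.integrable_cong_AE_complete[OF complete_area_measure[OF R] i ae]
    show "good (\<lambda>x x'. K x x' + L x x')"
      using c(1) ae' by (simp add: good_def)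
    show "J (\<lambda>x x'. K x x' + L x x') = J K + J L"
      using c(2) that unfolding J_def good_def by simp
  qed
  have scale: "good (\<lambda>x x'. c * K x x')" if "good K" for c K
    using that unfolding good_def by (auto elim: eventually_mono)
  \<comment> \<open>For nonzero \<open>c\<close>, integrability of a function and of its multiple
    coincide, so the default value \<open>0\<close> respects scaling at both levels.\<close>
  have J_scale: "J (\<lambda>x x'. c * K x x') = c * J K" for c K
    by (simp add: J_def)

  have F0: "integrable (completion (area_measure R \<Otimes>\<^sub>M area_measure S)) (\<lambda>(x, x'). F0 x x')"
    using assms(4) by (simp add: kernel_integrable_def F0_def)
  note Fs = kernel_weighted_integrable(2)[OF S R F0, of p', folded Fs_def]
  have good: "good F0" "good Fs" "good Fr" "good Fsr"
    using goodI[OF F0] goodI[OF Fs]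
      goodI[OF kernel_weighted_integrable(1)[OF S R F0, of p, folded Fr_def]]
      goodI[OF kernel_weighted_integrable(1)[OF S R Fs, of p, folded Fsr_def]]
    by simp_all

  have K: "kernel_integral F S R = J F0" "kernel_integral_src F p' S R = J Fs"
    "kernel_integral_rcv F p S R = J Fr" "kernel_integral_src_rcv F p' p S R = J Fsr"
    unfolding kernel_integral_def kernel_integral_src_def kernel_integral_rcv_def
      kernel_integral_src_rcv_def J_def F0_def Fs_def Fr_def Fsr_def
    by (simp_all add: mult_ac)

  have "kernel_integral F S' R' = s \<alpha> * complex_of_real (\<alpha> ^ 4) * J F0"
    using transport[of "\<lambda>x x'. 1"] by (simp add: kernel_integral_def)
  moreover have "kernel_integral_src F p' S' R'
      = s \<alpha> * complex_of_real (\<alpha> ^ 5) * (J Fs + complex_of_real (p' \<bullet> t) * J F0)"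
  proof -
    \<comment> \<open>The single factor \<alpha> split off the weight raises the fourth power from
      \<open>transport\<close> to the fifth.\<close>
    have "J (\<lambda>x x'. complex_of_real (p' \<bullet> \<tau> x') * F0 x x')
        = J (\<lambda>x x'. complex_of_real \<alpha> * (Fs x x' + complex_of_real (p' \<bullet> t) * F0 x x'))"
      by (simp add: \<tau>_def Fs_def algebra_simps inner_add_right)
    also have "\<dots> = complex_of_real \<alpha> * (J Fs + complex_of_real (p' \<bullet> t) * J F0)"
      by (simp only: J_scale add scale good)
    finally show ?thesis
      using transport[of "\<lambda>x x'. complex_of_real (p' \<bullet> x')"]
      by (simp add: kernel_integral_src_def power_numeral_reduce mult_ac)
  qed
  moreover have "kernel_integral_rcv F p S' R'
      = s \<alpha> * complex_of_real (\<alpha> ^ 5) * (J Fr + complex_of_real (p \<bullet> t) * J F0)"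
  proof -
    have "J (\<lambda>x x'. complex_of_real (p \<bullet> \<tau> x) * F0 x x')
        = J (\<lambda>x x'. complex_of_real \<alpha> * (Fr x x' + complex_of_real (p \<bullet> t) * F0 x x'))"
      by (simp add: \<tau>_def Fr_def algebra_simps inner_add_right)
    also have "\<dots> = complex_of_real \<alpha> * (J Fr + complex_of_real (p \<bullet> t) * J F0)"
      by (simp only: J_scale add scale good)
    finally show ?thesis
      using transport[of "\<lambda>x x'. complex_of_real (p \<bullet> x)"]
      by (simp add: kernel_integral_rcv_def power_numeral_reduce mult_ac)
  qed
  moreover have "kernel_integral_src_rcv F p' p S' R'
      = s \<alpha> * complex_of_real (\<alpha> ^ 6) * (J Fsr + complex_of_real (p \<bullet> t) * J Fs
          + complex_of_real (p' \<bullet> t) * J Fr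
          + complex_of_real (p \<bullet> t) * complex_of_real (p' \<bullet> t) * J F0)"
  proof -
    \<comment> \<open>Multiplying the two expanded weights gives the four terms and a factor
      \<open>\<alpha>\<^sup>2\<close>, hence the sixth power.\<close>
    have "J (\<lambda>x x'. complex_of_real (p' \<bullet> \<tau> x') * complex_of_real (p \<bullet> \<tau> x) * F0 x x')
        = J (\<lambda>x x'. complex_of_real (\<alpha>\<^sup>2) * (Fsr x x' + complex_of_real (p \<bullet> t) * Fs x x'
          + complex_of_real (p' \<bullet> t) * Fr x x'
          + complex_of_real (p \<bullet> t) * complex_of_real (p' \<bullet> t) * F0 x x'))"
      by (simp add: \<tau>_def Fs_def Fr_def Fsr_def algebra_simps inner_add_right power2_eq_square)
    also have "\<dots> = complex_of_real (\<alpha>\<^sup>2) * (J Fsr + complex_of_real (p \<bullet> t) * J Fs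
          + complex_of_real (p' \<bullet> t) * J Fr
          + complex_of_real (p \<bullet> t) * complex_of_real (p' \<bullet> t) * J F0)"
      \<comment> \<open>Splitting the nested sum requires its partial sums to be
        \<open>good\<close>, which closure under sums and multiples supplies.\<close>
      by (simp only: J_scale add scale good)
    finally show ?thesis
      using transport[of "\<lambda>x x'. complex_of_real (p' \<bullet> x') * complex_of_real (p \<bullet> x)"]
      by (simp add: kernel_integral_src_rcv_def power_numeral_reduce mult_ac)
  qed
  ultimately show ?thesis unfolding K by blast
qed

end
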